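(* Suppose $(S,\to,\twoheadrightarrow,\hookrightarrow)$ is a two-acyclic factorization system that obeys the image condition and $C\subseteq S$ is a $\rightsquigarrow$-upset. Then the restriction of $(S,\to,\twoheadrightarrow,\hookrightarrow)$ to $C$ is a two-acyclic factorization system that obeys the image condition. The map $(X,Y)\mapsto(X\cap C,Y\cap C)$ is a surjective complete lattice homomorphism between the corresponding lattices of maximal orthogonal pairs (from $\operatorname{Pairs}(\to)$ to $\operatorname{Pairs}(\to|_C)$). The complete congruence associated to $(X,Y)\mapsto(X\cap C,Y\cap C)$ is cover-determined. Every complete cover-determined congruence on $\operatorname{Pairs}(\to)$ arises from a $\rightsquigarrow$-upset in this way.
   Context: For a binary relation $\to$ on a set $S$ and $X\subseteq S$, put $X^\perp=\{y\in S: x\not\to y\ \forall x\in X\}$ and ${}^\perp X=\{y\in S: y\not\to x\ \forall x\in X\}$. A maximal orthogonal pair is a pair $(X,Y)$ of subsets of $S$ with $Y=X^\perp$ and $X={}^\perp Y$. $\operatorname{Pairs}(\to)$ is the complete lattice of maximal orthogonal pairs, partially ordered by containment of first components (equivalently reverse containment of second components). For a reflexive relation $\to$ on $S$, $\operatorname{Fact}(\to)=(\twoheadrightarrow,\hookrightarrow)$, where $x\twoheadrightarrow y$ iff for all $z$, $y\to z$ implies $x\to z$, and $x\hookrightarrow y$ iff for all $z$, $z\to x$ implies $z\to y$. For preorders $\twoheadrightarrow,\hookrightarrow$ on $S$, $\operatorname{Mult}(\twoheadrightarrow,\hookrightarrow)$ is the relation relating $x$ to $z$ iff there is $y\in S$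 with $x\twoheadrightarrow y\hookrightarrow z$. A factorization system is a tuple $(S,\to,\twoheadrightarrow,\hookrightarrow)$ ($S$ possibly infinite) with $\to$ reflexive, $\operatorname{Fact}(\to)=(\twoheadrightarrow,\hookrightarrow)$ and $\operatorname{Mult}(\twoheadrightarrow,\hookrightarrow)=\to$. It is two-acyclic if $x\twoheadrightarrow y\twoheadrightarrow x$ implies $x=y$, $x\hookrightarrow y\hookrightarrow x$ implies $x=y$, and $x\twoheadrightarrow y\hookrightarrow x$ implies $x=y$. Its restriction to $C\subseteq S$ restricts all three relations to $C$. Convention: $x\twoheadrightarrow y$ or $x\hookrightarrow y$ is read as "$x$ is greater than or equal to $y$"; thus $x$ is $\twoheadrightarrow$-minimal in $A\ni x$ if there is no $x'\in A\setminus\{x\}$ with $x\twoheadrightarrow x'$, and $\hookrightarrow$-maximal in $A$ if there is no $x'\in A\setminus\{x\}$ with $x'\hookrightarrow x$. For $y\in S$, $T(y)=\{x'\in S: y\twoheadrightarrow x'\}$ and $F(y)=\{x'\in S: x'\hookrightarrow y\}$. The relation $\rightsquigarrow$ on $S$: $x\rightsquigarrow y$ iff either $x$ is $\twoheadrightarrow$-minimal in $F(y)$ or $x$ is $\hookrightarrow$-maximal in $T(y)$. A $\rightsquigarrow$-upset is a subset $C\subseteq S$ such that $x\rightsquigarrow y$ and $y\in C$ imply $x\in C$. For $x\to z$, an image of $x\to z$ is a $\twoheadrightarrow$-minimal element of $\{y\in S: x\twoheadrightarrow y\hookrightarrow z\}$, and a co-image of $x\to z$ is a $\hookrightarrow$-maximal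 element of this set. The image condition: for all $x,z\in S$ with $x\to z$ there is at least one image and at least one co-image of $x\to z$. A complete lattice homomorphism preserves joins and meets of arbitrary nonempty subsets. A congruence is an equivalence relation respecting finite nonempty meets and joins; it is complete if it respects arbitrary nonempty meets and joins. The congruence associated to a surjective (complete) homomorphism is the one whose classes are its fibers. A congruence $\Theta$ on a lattice $L$ is cover-determined if, whenever $x\le y$ and $u\equiv v\bmod\Theta$ for all $u,v$ with $x\le u\lessdot v\le y$ ($\lessdot$ denoting the cover relation), then $x\equiv y\bmod\Theta$. *)

theory Defs
  imports "HOL-Algebra.Complete_Lattice"
begin

text \<open>Relations on a set S are sets of pairs contained in S \<times> S. The names ar, ep, mo stand for
  the arrows \<open>\<rightarrow>\<close>, the two-headed arrows and the hooked arrows of a factorization system.\<close>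

definition rperp :: "'a set \<Rightarrow> 'a rel \<Rightarrow> 'a set \<Rightarrow> 'a set" where
  "rperp S ar X = {y \<in> S. \<forall>x\<in>X. (x, y) \<notin> ar}"

definition lperp :: "'a set \<Rightarrow> 'a rel \<Rightarrow> 'a set \<Rightarrow> 'a set" where
  "lperp S ar X = {y \<in> S. \<forall>x\<in>X. (y, x) \<notin> ar}"

definition Pairs :: "'a set \<Rightarrow> 'a rel \<Rightarrow> ('a set \<times> 'a set) gorder" where
  "Pairs S ar =
     \<lparr>carrier = {(X, Y). X \<subseteq> S \<and> Y \<subseteq> S \<and> Y = rperp S ar X \<and> X = lperp S ar Y},
      eq = (=), le = (\<lambda>p q. fst p \<subseteq> fst q)\<rparr>"

definition Fact :: "'a set \<Rightarrow> 'a rel \<Rightarrow> 'a rel \<times> 'a rel" where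
  "Fact S ar =
     ({(x, y) \<in> S \<times> S. \<forall>z\<in>S. (y, z) \<in> ar \<longrightarrow> (x, z) \<in> ar},
      {(x, y) \<in> S \<times> S. \<forall>z\<in>S. (z, x) \<in> ar \<longrightarrow> (z, y) \<in> ar})"

definition Mult :: "'a set \<Rightarrow> 'a rel \<Rightarrow> 'a rel \<Rightarrow> 'a rel" where
  "Mult S ep mo = {(x, z) \<in> S \<times> S. \<exists>y\<in>S. (x, y) \<in> ep \<and> (y, z) \<in> mo}"

definition factorization_system :: "'a set \<Rightarrow> 'a rel \<Rightarrow> 'a rel \<Rightarrow> 'a rel \<Rightarrow> bool" where
  "factorization_system S ar ep mo \<longleftrightarrow>
     ar \<subseteq> S \<times> S \<and> refl_on S ar \<and> Fact S ar = (ep, mo) \<and> Mult S ep mo = ar"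

definition two_acyclic :: "'a rel \<Rightarrow> 'a rel \<Rightarrow> bool" where
  "two_acyclic ep mo \<longleftrightarrow>
     (\<forall>x y. (x, y) \<in> ep \<and> (y, x) \<in> ep \<longrightarrow> x = y) \<and>
     (\<forall>x y. (x, y) \<in> mo \<and> (y, x) \<in> mo \<longrightarrow> x = y) \<and>
     (\<forall>x y. (x, y) \<in> ep \<and> (y, x) \<in> mo \<longrightarrow> x = y)"

text \<open>A pair (x, y) in a preorder R is read as: x is greater than or equal to y.\<close>

definition minimal_in :: "'a rel \<Rightarrow> 'a set \<Rightarrow> 'a \<Rightarrow> bool" where
  "minimal_in R A x \<longleftrightarrow> x \<in> A \<and> \<not> (\<exists>x'\<in>A - {x}. (x, x') \<in> R)"

definition maximal_in :: "'a rel \<Rightarrow> 'a set \<Rightarrow> 'a \<Rightarrow> bool" where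
  "maximal_in R A x \<longleftrightarrow> x \<in> A \<and> \<not> (\<exists>x'\<in>A - {x}. (x', x) \<in> R)"

definition T_set :: "'a set \<Rightarrow> 'a rel \<Rightarrow> 'a \<Rightarrow> 'a set" where
  "T_set S ep y = {x' \<in> S. (y, x') \<in> ep}"

definition F_set :: "'a set \<Rightarrow> 'a rel \<Rightarrow> 'a \<Rightarrow> 'a set" where
  "F_set S mo y = {x' \<in> S. (x', y) \<in> mo}"

definition squig :: "'a set \<Rightarrow> 'a rel \<Rightarrow> 'a rel \<Rightarrow> 'a rel" where
  "squig S ep mo =
     {(x, y) \<in> S \<times> S. minimal_in ep (F_set S mo y) x \<or> maximal_in mo (T_set S ep y) x}"

definition squig_upset :: "'a set \<Rightarrow> 'a rel \<Rightarrow> 'a rel \<Rightarrow> 'a set \<Rightarrow> bool" where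
  "squig_upset S ep mo C \<longleftrightarrow> C \<subseteq> S \<and> (\<forall>x y. (x, y) \<in> squig S ep mo \<and> y \<in> C \<longrightarrow> x \<in> C)"

definition factorizations :: "'a set \<Rightarrow> 'a rel \<Rightarrow> 'a rel \<Rightarrow> 'a \<Rightarrow> 'a \<Rightarrow> 'a set" where
  "factorizations S ep mo x z = {y \<in> S. (x, y) \<in> ep \<and> (y, z) \<in> mo}"

definition is_image :: "'a set \<Rightarrow> 'a rel \<Rightarrow> 'a rel \<Rightarrow> 'a \<Rightarrow> 'a \<Rightarrow> 'a \<Rightarrow> bool" where
  "is_image S ep mo x z y \<longleftrightarrow> minimal_in ep (factorizations S ep mo x z) y"

definition is_coimage :: "'a set \<Rightarrow> 'a rel \<Rightarrow> 'a rel \<Rightarrow> 'a \<Rightarrow> 'a \<Rightarrow> 'a \<Rightarrow> bool" where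
  "is_coimage S ep mo x z y \<longleftrightarrow> maximal_in mo (factorizations S ep mo x z) y"

definition image_condition :: "'a set \<Rightarrow> 'a rel \<Rightarrow> 'a rel \<Rightarrow> 'a rel \<Rightarrow> bool" where
  "image_condition S ar ep mo \<longleftrightarrow>
     (\<forall>x\<in>S. \<forall>z\<in>S. (x, z) \<in> ar \<longrightarrow>
        (\<exists>y. is_image S ep mo x z y) \<and> (\<exists>y. is_coimage S ep mo x z y))"

definition complete_lattice_hom ::
  "('a, 'm) gorder_scheme \<Rightarrow> ('b, 'n) gorder_scheme \<Rightarrow> ('a \<Rightarrow> 'b) \<Rightarrow> bool" where
  "complete_lattice_hom L M f \<longleftrightarrow>
     complete_lattice L \<and> complete_lattice M \<and> f ` carrier L \<subseteq> carrier M \<and>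
     (\<forall>A. A \<subseteq> carrier L \<and> A \<noteq> {} \<longrightarrow>
        f (\<Squnion>\<^bsub>L\<^esub> A) = \<Squnion>\<^bsub>M\<^esub> (f ` A) \<and> f (\<Sqinter>\<^bsub>L\<^esub> A) = \<Sqinter>\<^bsub>M\<^esub> (f ` A))"

text \<open>Two families with pointwise congruent members are encoded by the set R of the pairs of
  corresponding members; this avoids quantifying over an index type and loses no generality.\<close>

definition respects_joins_meets ::
  "('a, 'm) gorder_scheme \<Rightarrow> 'a rel \<Rightarrow> 'a rel \<Rightarrow> bool" where
  "respects_joins_meets L \<Theta> R \<longleftrightarrow>
     (\<Squnion>\<^bsub>L\<^esub> (fst ` R), \<Squnion>\<^bsub>L\<^esub> (snd ` R)) \<in> \<Theta> \<and> (\<Sqinter>\<^bsub>L\<^esub> (fst ` R), \<Sqinter>\<^bsub>L\<^esub> (snd ` R)) \<in> \<Theta>"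

definition lattice_congruence :: "('a, 'm) gorder_scheme \<Rightarrow> 'a rel \<Rightarrow> bool" where
  "lattice_congruence L \<Theta> \<longleftrightarrow>
     equiv (carrier L) \<Theta> \<and>
     (\<forall>R. R \<subseteq> \<Theta> \<and> R \<noteq> {} \<and> finite R \<longrightarrow> respects_joins_meets L \<Theta> R)"

definition complete_congruence :: "('a, 'm) gorder_scheme \<Rightarrow> 'a rel \<Rightarrow> bool" where
  "complete_congruence L \<Theta> \<longleftrightarrow>
     lattice_congruence L \<Theta> \<and> (\<forall>R. R \<subseteq> \<Theta> \<and> R \<noteq> {} \<longrightarrow> respects_joins_meets L \<Theta> R)"

definition fiber_congruence :: "('a, 'm) gorder_scheme \<Rightarrow> ('a \<Rightarrow> 'b) \<Rightarrow> 'a rel" where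
  "fiber_congruence L f = {(p, q) \<in> carrier L \<times> carrier L. f p = f q}"

definition covered_by :: "('a, 'm) gorder_scheme \<Rightarrow> 'a \<Rightarrow> 'a \<Rightarrow> bool" where
  "covered_by L u v \<longleftrightarrow>
     u \<in> carrier L \<and> v \<in> carrier L \<and> u \<sqsubset>\<^bsub>L\<^esub> v \<and>
     \<not> (\<exists>w\<in>carrier L. u \<sqsubset>\<^bsub>L\<^esub> w \<and> w \<sqsubset>\<^bsub>L\<^esub> v)"

definition cover_determined :: "('a, 'm) gorder_scheme \<Rightarrow> 'a rel \<Rightarrow> bool" where
  "cover_determined L \<Theta> \<longleftrightarrow>
     (\<forall>x\<in>carrier L. \<forall>y\<in>carrier L.
        x \<sqsubseteq>\<^bsub>L\<^esub> y \<and>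
        (\<forall>u v. x \<sqsubseteq>\<^bsub>L\<^esub> u \<and> covered_by L u v \<and> v \<sqsubseteq>\<^bsub>L\<^esub> y \<longrightarrow> (u, v) \<in> \<Theta>) \<longrightarrow>
        (x, y) \<in> \<Theta>)"

definition restrict_pair :: "'a set \<Rightarrow> 'a set \<times> 'a set \<Rightarrow> 'a set \<times> 'a set" where
  "restrict_pair C = (\<lambda>(X, Y). (X \<inter> C, Y \<inter> C))"

end

theory Submission
  imports Defs
begin

text \<open>
  For \<open>c \<in> S\<close>, the pair with first component \<open>T(c)\<close> is completely join-irreducible, with lower cover
  \<open>T(c) - {c}\<close>; dually, the pair with second component \<open>F(c)\<close> is completely meet-irreducible, with
  upper cover \<open>F(c) - {c}\<close>. Every cover \<open>(X, Y) \<lessdot> (X', Y')\<close> is perspective to the cover below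
  \<open>T(c)\<close> for each \<open>c \<in> X' \<inter> Y\<close>, and whenever \<open>(X, Y) \<le> (X', Y')\<close> every \<open>c \<in> X' \<inter> Y\<close> labels a cover
  in that interval. Hence a cover-determined congruence is determined by the set of \<open>c\<close> whose
  cover below \<open>T(c)\<close> it does not contract, and this set is a \<open>\<leadsto>\<close>-upset. Conversely, images and
  co-images of arrows with an endpoint in an upset \<open>C\<close> can be chosen in \<open>C\<close>, so \<open>C\<close> detects
  orthogonality.
\<close>

section \<open>Maximal orthogonal pairs\<close>

lemma Pairs_simps [simp]:
  "le (Pairs S ar) p q \<longleftrightarrow> fst p \<subseteq> fst q"
  "p .=\<^bsub>Pairs S ar\<^esub> q \<longleftrightarrow> p = q"
  "lless (Pairs S ar) p q \<longleftrightarrow> fst p \<subseteq> fst q \<and> p \<noteq> q"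
  by (simp_all add: Pairs_def lless_def)

lemma mem_Pairs:
  "p \<in> carrier (Pairs S ar) \<longleftrightarrow> snd p = rperp S ar (fst p) \<and> fst p = lperp S ar (snd p)"
  by (auto simp: Pairs_def rperp_def lperp_def)

lemma fst_subset: "p \<in> carrier (Pairs S ar) \<Longrightarrow> fst p \<subseteq> S"
  and snd_subset: "p \<in> carrier (Pairs S ar) \<Longrightarrow> snd p \<subseteq> S"
  unfolding mem_Pairs rperp_def lperp_def by blast+

lemma mem_fst_iff:
  "p \<in> carrier (Pairs S ar) \<Longrightarrow> x \<in> fst p \<longleftrightarrow> x \<in> S \<and> (\<forall>y\<in>snd p. (x, y) \<notin> ar)"
  unfolding mem_Pairs lperp_def by blast

lemma mem_snd_iff:
  "p \<in> carrier (Pairs S ar) \<Longrightarrow> y \<in> snd p \<longleftrightarrow> y \<in> S \<and> (\<forall>x\<in>fst p. (x, y) \<notin> ar)"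
  unfolding mem_Pairs rperp_def by blast

text \<open>\<open>rperp\<close> and \<open>lperp\<close> form an antitone Galois connection, so
  applying them three times in alternation gives the same as applying one once. This and the next
  lemma are the only sources of pairs needed below.\<close>

lemma lperp_mem_Pairs: "B \<subseteq> S \<Longrightarrow> (lperp S ar B, rperp S ar (lperp S ar B)) \<in> carrier (Pairs S ar)"
  by (fastforce simp: mem_Pairs rperp_def lperp_def)

lemma rperp_mem_Pairs: "A \<subseteq> S \<Longrightarrow> (lperp S ar (rperp S ar A), rperp S ar A) \<in> carrier (Pairs S ar)"
  by (fastforce simp: mem_Pairs rperp_def lperp_def)

lemma Pairs_eqI1:
  "p \<in> carrier (Pairs S ar) \<Longrightarrow> q \<in> carrier (Pairs S ar) \<Longrightarrow> fst p = fst q \<Longrightarrow> p = q"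
  by (metis mem_Pairs prod_eq_iff)

lemma Pairs_eqI2:
  "p \<in> carrier (Pairs S ar) \<Longrightarrow> q \<in> carrier (Pairs S ar) \<Longrightarrow> snd p = snd q \<Longrightarrow> p = q"
  by (metis mem_Pairs prod_eq_iff)

text \<open>Both perps are antitone and each component is the perp of the other. The order may thus
  be read off whichever component is convenient: first components for meets, second components for
  joins.\<close>

lemma fst_subset_iff_snd_subset:
  assumes "p \<in> carrier (Pairs S ar)" "q \<in> carrier (Pairs S ar)"
  shows "fst p \<subseteq> fst q \<longleftrightarrow> snd q \<subseteq> snd p"
proof -
  have "rperp S ar B \<subseteq> rperp S ar A" "lperp S ar B \<subseteq> lperp S ar A" if "A \<subseteq> B" for A B
    using that by (auto simp: rperp_def lperp_def)
  then show ?thesis using assms by (metis mem_Pairs)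
qed

section \<open>Completeness: meets intersect first components, joins intersect second
  components\<close>

lemma partial_order_Pairs: "partial_order (Pairs S ar)"
proof unfold_locales
  show "x .=\<^bsub>Pairs S ar\<^esub> y"
    if "x \<sqsubseteq>\<^bsub>Pairs S ar\<^esub> y" "y \<sqsubseteq>\<^bsub>Pairs S ar\<^esub> x" "x \<in> carrier (Pairs S ar)" "y \<in> carrier (Pairs S ar)" for x y
    using that Pairs_eqI1 by (metis Pairs_simps(1,2) subset_antisym)
  show "(.=\<^bsub>Pairs S ar\<^esub>) = (=)" by (intro ext) simp
qed auto

text \<open>An intersection of first components is \<open>lperp\<close> of the union of the second
  components, hence closed. The explicit \<open>S\<close> covers the empty family, whose
  \<open>\<Inter>\<close> would be the whole type.\<close>

lemma greatest_Lower_Pairs: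
  assumes "A \<subseteq> carrier (Pairs S ar)"
  shows "\<exists>i. greatest (Pairs S ar) i (Lower (Pairs S ar) A) \<and> fst i = S \<inter> \<Inter>(fst ` A)"
proof -
  have *: "S \<inter> \<Inter>(fst ` A) = lperp S ar (\<Union>(snd ` A))"
    using assms mem_fst_iff[of _ S ar] by (fastforce simp: lperp_def)
  have "\<Union>(snd ` A) \<subseteq> S" using assms snd_subset by blast
  from lperp_mem_Pairs[OF this, of ar]
  have i: "(S \<inter> \<Inter>(fst ` A), rperp S ar (S \<inter> \<Inter>(fst ` A))) \<in> carrier (Pairs S ar)"
    (is "?i \<in> _") unfolding * [symmetric] .
  have "greatest (Pairs S ar) ?i (Lower (Pairs S ar) A)"
  proof (rule greatest_LowerI)
    show "?i \<sqsubseteq>\<^bsub>Pairs S ar\<^esub> p" if "p \<in> A" for p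
      using that by auto
    show "q \<sqsubseteq>\<^bsub>Pairs S ar\<^esub> ?i" if "q \<in> Lower (Pairs S ar) A" for q
    proof -
      have "q \<in> carrier (Pairs S ar)" using that by (simp add: Lower_def)
      moreover have "fst q \<subseteq> fst p" if "p \<in> A" for p
        using \<open>q \<in> Lower _ _\<close> that assms unfolding Lower_def Pairs_simps by blast
      ultimately show ?thesis using fst_subset[of q S ar] by auto
    qed
  qed (use i assms in auto)
  then show ?thesis by force
qed

lemma least_Upper_Pairs:
  assumes "A \<subseteq> carrier (Pairs S ar)"
  shows "\<exists>s. least (Pairs S ar) s (Upper (Pairs S ar) A) \<and> snd s = S \<inter> \<Inter>(snd ` A)"
proof -
  let ?s = "(lperp S ar (S \<inter> \<Inter>(snd ` A)), S \<inter> \<Inter>(snd ` A))"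
  have *: "S \<inter> \<Inter>(snd ` A) = rperp S ar (\<Union>(fst ` A))"
    using assms mem_snd_iff[of _ S ar] by (fastforce simp: rperp_def)
  have "\<Union>(fst ` A) \<subseteq> S" using assms fst_subset by blast
  from rperp_mem_Pairs[OF this, of ar] have s: "?s \<in> carrier (Pairs S ar)"
    by (simp add: *)
  have "least (Pairs S ar) ?s (Upper (Pairs S ar) A)"
  proof (rule least_UpperI)
    show "p \<sqsubseteq>\<^bsub>Pairs S ar\<^esub> ?s" if "p \<in> A" for p
      using fst_subset_iff_snd_subset[of p S ar ?s] s that assms by auto
    show "?s \<sqsubseteq>\<^bsub>Pairs S ar\<^esub> q" if q: "q \<in> Upper (Pairs S ar) A" for q
    proof -
      have c: "q \<in> carrier (Pairs S ar)" using q by (simp add: Upper_def)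
      have "snd q \<subseteq> snd p" if "p \<in> A" for p
      proof -
        have "p \<in> carrier (Pairs S ar)" using that assms by blast
        moreover have "fst p \<subseteq> fst q"
          using q that assms unfolding Upper_def Pairs_simps by blast
        ultimately show ?thesis using fst_subset_iff_snd_subset[of p S ar q] c by blast
      qed
      then have "snd q \<subseteq> snd ?s" using snd_subset[OF c] by auto
      then show ?thesis using fst_subset_iff_snd_subset[OF s c] by simp
    qed
  qed (use s assms in auto)
  then show ?thesis by force
qed

lemma complete_lattice_Pairs: "complete_lattice (Pairs S ar)"
proof (rule partial_order.complete_latticeI[OF partial_order_Pairs])
  fix A assume A: "A \<subseteq> carrier (Pairs S ar)"
  show "\<exists>s. least (Pairs S ar) s (Upper (Pairs S ar) A)"
    using least_Upper_Pairs[OF A] by (elim exE conjE) (rule exI)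
  show "\<exists>i. greatest (Pairs S ar) i (Lower (Pairs S ar) A)"
    using greatest_Lower_Pairs[OF A] by (elim exE conjE) (rule exI)
qed

text \<open>The infimum is a Hilbert choice among the greatest lower bounds, so its first component
  is compared with that of a known one.\<close>

lemma
  assumes "A \<subseteq> carrier (Pairs S ar)"
  shows Inf_Pairs_closed: "\<Sqinter>\<^bsub>Pairs S ar\<^esub> A \<in> carrier (Pairs S ar)"
    and fst_Inf_Pairs: "fst (\<Sqinter>\<^bsub>Pairs S ar\<^esub> A) = S \<inter> \<Inter>(fst ` A)"
proof -
  let ?L = "Pairs S ar"
  obtain i where i: "greatest ?L i (Lower ?L A)" "fst i = S \<inter> \<Inter>(fst ` A)"
    using greatest_Lower_Pairs[OF assms] by blast
  from i(1) have g: "greatest ?L (\<Sqinter>\<^bsub>?L\<^esub> A) (Lower ?L A)"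
    unfolding inf_def by (rule someI)
  then show "\<Sqinter>\<^bsub>?L\<^esub> A \<in> carrier ?L" unfolding greatest_def by blast
  have "fst (\<Sqinter>\<^bsub>?L\<^esub> A) = fst i"
    using g i(1) unfolding greatest_def Pairs_simps by blast
  with i(2) show "fst (\<Sqinter>\<^bsub>?L\<^esub> A) = S \<inter> \<Inter>(fst ` A)" by simp
qed

lemma
  assumes "A \<subseteq> carrier (Pairs S ar)"
  shows Sup_Pairs_closed: "\<Squnion>\<^bsub>Pairs S ar\<^esub> A \<in> carrier (Pairs S ar)"
    and snd_Sup_Pairs: "snd (\<Squnion>\<^bsub>Pairs S ar\<^esub> A) = S \<inter> \<Inter>(snd ` A)"
proof -
  let ?L = "Pairs S ar"
  obtain s where s: "least ?L s (Upper ?L A)" "snd s = S \<inter> \<Inter>(snd ` A)"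
    using least_Upper_Pairs[OF assms] by blast
  from s(1) have g: "least ?L (\<Squnion>\<^bsub>?L\<^esub> A) (Upper ?L A)"
    unfolding sup_def by (rule someI)
  then show c: "\<Squnion>\<^bsub>?L\<^esub> A \<in> carrier ?L" unfolding least_def by blast
  have "s \<in> carrier ?L" using s(1) unfolding least_def by blast
  moreover have "fst (\<Squnion>\<^bsub>?L\<^esub> A) = fst s"
    using g s(1) unfolding least_def Pairs_simps by blast
  \<comment> \<open>The order compares first components only, so the second component becomes
    accessible through equality of the whole pairs.\<close>
  ultimately have "\<Squnion>\<^bsub>?L\<^esub> A = s" using c by (intro Pairs_eqI1)
  with s(2) show "snd (\<Squnion>\<^bsub>?L\<^esub> A) = S \<inter> \<Inter>(snd ` A)" by simp
qed

lemma
  assumes "p \<in> carrier (Pairs S ar)" "q \<in> carrier (Pairs S ar)"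
  shows meet_Pairs_closed: "p \<sqinter>\<^bsub>Pairs S ar\<^esub> q \<in> carrier (Pairs S ar)"
    and fst_meet_Pairs: "fst (p \<sqinter>\<^bsub>Pairs S ar\<^esub> q) = fst p \<inter> fst q"
    and join_Pairs_closed: "p \<squnion>\<^bsub>Pairs S ar\<^esub> q \<in> carrier (Pairs S ar)"
    and snd_join_Pairs: "snd (p \<squnion>\<^bsub>Pairs S ar\<^esub> q) = snd p \<inter> snd q"
  using assms Inf_Pairs_closed[of "{p, q}" S ar] fst_Inf_Pairs[of "{p, q}" S ar]
    Sup_Pairs_closed[of "{p, q}" S ar] snd_Sup_Pairs[of "{p, q}" S ar]
    fst_subset[OF assms(1)] snd_subset[OF assms(1)]
  by (auto simp: meet_def join_def)

lemma
  assumes "p \<in> carrier (Pairs S ar)" "q \<in> carrier (Pairs S ar)" "fst p \<subseteq> fst q"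
  shows meet_absorb: "p \<sqinter>\<^bsub>Pairs S ar\<^esub> q = p" "q \<sqinter>\<^bsub>Pairs S ar\<^esub> p = p"
  by (rule Pairs_eqI1; use assms in \<open>auto simp: meet_Pairs_closed fst_meet_Pairs\<close>)+

lemma
  assumes "p \<in> carrier (Pairs S ar)" "q \<in> carrier (Pairs S ar)" "fst p \<subseteq> fst q"
  shows join_absorb: "p \<squnion>\<^bsub>Pairs S ar\<^esub> q = q" "q \<squnion>\<^bsub>Pairs S ar\<^esub> p = q"
  by (rule Pairs_eqI2;
      use assms fst_subset_iff_snd_subset[OF assms(1,2)] in \<open>auto simp: join_Pairs_closed snd_join_Pairs\<close>)+

lemma fst_join_upper:
  assumes "p \<in> carrier (Pairs S ar)" "q \<in> carrier (Pairs S ar)"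
  shows "fst p \<subseteq> fst (p \<squnion>\<^bsub>Pairs S ar\<^esub> q)" "fst q \<subseteq> fst (p \<squnion>\<^bsub>Pairs S ar\<^esub> q)"
  using assms fst_subset_iff_snd_subset join_Pairs_closed snd_join_Pairs by (metis inf_le1 inf_le2)+

lemma fst_join_least:
  assumes "p \<in> carrier (Pairs S ar)" "q \<in> carrier (Pairs S ar)" "r \<in> carrier (Pairs S ar)" "fst p \<subseteq> fst r" "fst q \<subseteq> fst r"
  shows "fst (p \<squnion>\<^bsub>Pairs S ar\<^esub> q) \<subseteq> fst r"
  using assms fst_subset_iff_snd_subset join_Pairs_closed snd_join_Pairs by (metis le_inf_iff)

section \<open>Congruences on lattices and fibers of homomorphisms\<close>

lemma lattice_congruence_meet:
  assumes "lattice_congruence L \<Theta>" "(p, q) \<in> \<Theta>" "r \<in> carrier L"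
  shows "(p \<sqinter>\<^bsub>L\<^esub> r, q \<sqinter>\<^bsub>L\<^esub> r) \<in> \<Theta>"
proof -
  have "{(p, q), (r, r)} \<subseteq> \<Theta>"
    using assms by (auto simp: lattice_congruence_def equiv_def refl_on_def)
  then have "respects_joins_meets L \<Theta> {(p, q), (r, r)}"
    using assms by (simp add: lattice_congruence_def)
  then show ?thesis by (simp add: respects_joins_meets_def meet_def)
qed

lemma lattice_congruence_join:
  assumes "lattice_congruence L \<Theta>" "(p, q) \<in> \<Theta>" "r \<in> carrier L"
  shows "(p \<squnion>\<^bsub>L\<^esub> r, q \<squnion>\<^bsub>L\<^esub> r) \<in> \<Theta>"
proof -
  have "{(p, q), (r, r)} \<subseteq> \<Theta>"
    using assms by (auto simp: lattice_congruence_def equiv_def refl_on_def)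
  then have "respects_joins_meets L \<Theta> {(p, q), (r, r)}"
    using assms by (simp add: lattice_congruence_def)
  then show ?thesis by (simp add: respects_joins_meets_def join_def)
qed

text \<open>Meeting both sides with \<open>q\<close> sends a congruent pair \<open>(p, q)\<close> to
  \<open>(p \<sqinter> q, q)\<close>; symmetry and transitivity do the rest. Its use is that two
  congruences agreeing on comparable pairs are equal.\<close>

lemma lattice_congruence_iff_meet:
  assumes cong: "lattice_congruence (Pairs S ar) \<Theta>"
    and "p \<in> carrier (Pairs S ar)" "q \<in> carrier (Pairs S ar)"
  shows "(p, q) \<in> \<Theta> \<longleftrightarrow>
    (p \<sqinter>\<^bsub>Pairs S ar\<^esub> q, p) \<in> \<Theta> \<and> (p \<sqinter>\<^bsub>Pairs S ar\<^esub> q, q) \<in> \<Theta>"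
proof -
  let ?L = "Pairs S ar"
  have eq: "equiv (carrier ?L) \<Theta>" using cong by (simp add: lattice_congruence_def)
  have sym: "sym \<Theta>" and trans: "trans \<Theta>" using eq by (auto elim: equivE)
  have "q \<sqinter>\<^bsub>?L\<^esub> q = q" using assms
    by (intro Pairs_eqI1) (auto simp: fst_meet_Pairs meet_Pairs_closed)
  then have "(p \<sqinter>\<^bsub>?L\<^esub> q, q) \<in> \<Theta>" if "(p, q) \<in> \<Theta>"
    using lattice_congruence_meet[OF cong that assms(3)] by simp
  then show ?thesis using sym trans by (meson symD transD)
qed

lemma complete_congruence_fiber:
  assumes hom: "complete_lattice_hom L M f"
  shows "complete_congruence L (fiber_congruence L f)"
proof -
  interpret complete_lattice L using hom by (simp add: complete_lattice_hom_def)
  let ?\<Theta> = "fiber_congruence L f"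
  have "equiv (carrier L) ?\<Theta>"
    by (auto simp: fiber_congruence_def equiv_def refl_on_def sym_def trans_def)
  moreover have "respects_joins_meets L ?\<Theta> R" if "R \<subseteq> ?\<Theta>" "R \<noteq> {}" for R
  proof -
    have "fst ` R \<subseteq> carrier L" "snd ` R \<subseteq> carrier L"
      using that by (auto simp: fiber_congruence_def)
    moreover have "(\<lambda>r. f (fst r)) ` R = (\<lambda>r. f (snd r)) ` R"
      using that by (intro image_cong) (auto simp: fiber_congruence_def)
    then have "f ` fst ` R = f ` snd ` R" by (simp add: image_image)
    ultimately show ?thesis
      using hom \<open>R \<noteq> {}\<close>
      by (simp add: complete_lattice_hom_def respects_joins_meets_def fiber_congruence_def)
  qed
  ultimately show ?thesis by (simp add: complete_congruence_def lattice_congruence_def)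
qed

section \<open>Two-acyclic factorization systems with images and co-images\<close>

locale two_acyclic_factorization_system =
  fixes S :: "'a set" and ar ep mo :: "'a rel"
  assumes fs: "factorization_system S ar ep mo"
    and ta: "two_acyclic ep mo"
    and ic: "image_condition S ar ep mo"
begin

abbreviation \<P> where "\<P> \<equiv> Pairs S ar"

text \<open>Since \<open>ar\<close> lives on \<open>S\<close>, the bounded quantifiers in
  \<open>Fact\<close> and \<open>Mult\<close> can be made unbounded.\<close>

lemma ar_carrier: "(x, y) \<in> ar \<Longrightarrow> x \<in> S" "(x, y) \<in> ar \<Longrightarrow> y \<in> S"
  and ar_refl: "x \<in> S \<Longrightarrow> (x, x) \<in> ar"
  and ep_iff: "(x, y) \<in> ep \<longleftrightarrow> x \<in> S \<and> y \<in> S \<and> (\<forall>z. (y, z) \<in> ar \<longrightarrow> (x, z) \<in> ar)"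
  and mo_iff: "(x, y) \<in> mo \<longleftrightarrow> x \<in> S \<and> y \<in> S \<and> (\<forall>z. (z, x) \<in> ar \<longrightarrow> (z, y) \<in> ar)"
  and ar_iff: "(x, y) \<in> ar \<longleftrightarrow> (\<exists>w. (x, w) \<in> ep \<and> (w, y) \<in> mo)"
proof -
  show ar: "(x, y) \<in> ar \<Longrightarrow> x \<in> S" "(x, y) \<in> ar \<Longrightarrow> y \<in> S" for x y
    using fs by (auto simp: factorization_system_def)
  show "x \<in> S \<Longrightarrow> (x, x) \<in> ar"
    using fs by (auto simp: factorization_system_def refl_on_def)
  have e: "ep = {(x, y) \<in> S \<times> S. \<forall>z\<in>S. (y, z) \<in> ar \<longrightarrow> (x, z) \<in> ar}"
    and m: "mo = {(x, y) \<in> S \<times> S. \<forall>z\<in>S. (z, x) \<in> ar \<longrightarrow> (z, y) \<in> ar}"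
    using fs by (simp_all add: factorization_system_def Fact_def)
  show ep: "(x, y) \<in> ep \<longleftrightarrow> x \<in> S \<and> y \<in> S \<and> (\<forall>z. (y, z) \<in> ar \<longrightarrow> (x, z) \<in> ar)" for x y
    unfolding e using ar by blast
  show mo: "(x, y) \<in> mo \<longleftrightarrow> x \<in> S \<and> y \<in> S \<and> (\<forall>z. (z, x) \<in> ar \<longrightarrow> (z, y) \<in> ar)" for x y
    unfolding m using ar by blast
  have "ar = Mult S ep mo" using fs by (simp add: factorization_system_def)
  then have "(x, y) \<in> ar \<longleftrightarrow> x \<in> S \<and> y \<in> S \<and> (\<exists>w\<in>S. (x, w) \<in> ep \<and> (w, y) \<in> mo)"
    by (simp add: Mult_def)
  then show "(x, y) \<in> ar \<longleftrightarrow> (\<exists>w. (x, w) \<in> ep \<and> (w, y) \<in> mo)"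
    using ep mo by blast
qed

lemma ep_carrier: "(x, y) \<in> ep \<Longrightarrow> x \<in> S" "(x, y) \<in> ep \<Longrightarrow> y \<in> S"
  and mo_carrier: "(x, y) \<in> mo \<Longrightarrow> x \<in> S" "(x, y) \<in> mo \<Longrightarrow> y \<in> S"
  and ep_refl: "x \<in> S \<Longrightarrow> (x, x) \<in> ep" and mo_refl: "x \<in> S \<Longrightarrow> (x, x) \<in> mo"
  and ep_trans: "(x, y) \<in> ep \<Longrightarrow> (y, z) \<in> ep \<Longrightarrow> (x, z) \<in> ep"
  and mo_trans: "(x, y) \<in> mo \<Longrightarrow> (y, z) \<in> mo \<Longrightarrow> (x, z) \<in> mo"
  and ep_ar_trans: "(x, y) \<in> ep \<Longrightarrow> (y, z) \<in> ar \<Longrightarrow> (x, z) \<in> ar"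
  and ar_mo_trans: "(x, y) \<in> ar \<Longrightarrow> (y, z) \<in> mo \<Longrightarrow> (x, z) \<in> ar"
  by (simp_all add: ep_iff mo_iff)

lemma ep_imp_ar: "(x, y) \<in> ep \<Longrightarrow> (x, y) \<in> ar"
  and mo_imp_ar: "(x, y) \<in> mo \<Longrightarrow> (x, y) \<in> ar"
  using ar_iff ep_refl mo_refl ep_carrier mo_carrier by blast+

lemma ep_antisym: "(x, y) \<in> ep \<Longrightarrow> (y, x) \<in> ep \<Longrightarrow> x = y"
  and mo_antisym: "(x, y) \<in> mo \<Longrightarrow> (y, x) \<in> mo \<Longrightarrow> x = y"
  and ep_mo_cycle: "(x, y) \<in> ep \<Longrightarrow> (y, x) \<in> mo \<Longrightarrow> x = y"
  using ta unfolding two_acyclic_def by blast+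

text \<open>Factor the arrow as \<open>ep\<close> followed by \<open>mo\<close>. Composing the
  \<open>mo\<close> part with the given \<open>mo\<close> closes a mixed cycle, which collapses the
  middle element to \<open>x\<close>; antisymmetry of \<open>mo\<close> finishes. The next lemma is
  dual.\<close>

lemma ar_mo_cycle: "(x, y) \<in> ar \<Longrightarrow> (y, x) \<in> mo \<Longrightarrow> x = y"
  by (metis ar_iff ep_mo_cycle mo_antisym mo_trans)

lemma ep_ar_cycle: "(x, y) \<in> ep \<Longrightarrow> (y, x) \<in> ar \<Longrightarrow> x = y"
  by (metis ar_iff ep_mo_cycle ep_antisym ep_trans)

lemma fst_ep_closed: "p \<in> carrier \<P> \<Longrightarrow> x \<in> fst p \<Longrightarrow> (x, y) \<in> ep \<Longrightarrow> y \<in> fst p"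
  using mem_fst_iff ep_ar_trans ep_carrier by metis

lemma snd_mo_closed: "p \<in> carrier \<P> \<Longrightarrow> y \<in> snd p \<Longrightarrow> (x, y) \<in> mo \<Longrightarrow> x \<in> snd p"
  using mem_snd_iff ar_mo_trans mo_carrier by metis

lemma fst_snd_disjoint: "p \<in> carrier \<P> \<Longrightarrow> x \<in> fst p \<Longrightarrow> x \<notin> snd p"
  using mem_snd_iff fst_subset ar_refl by (metis subsetD)

text \<open>An image \<open>y\<close> is minimal in all of \<open>F(z)\<close>, not merely among the
  factorizations: anything in \<open>F(z)\<close> that \<open>y\<close> reaches by \<open>ep\<close>
  is also reached from \<open>x\<close>, hence is again a factorization. This yields
  \<open>y \<leadsto> z\<close>, the way in which upsets come to contain images.\<close>

lemma image_exists:
  assumes "(x, z) \<in> ar"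
  obtains y where "(x, y) \<in> ep" "(y, z) \<in> mo" "(y, z) \<in> squig S ep mo" "is_image S ep mo x z y"
proof -
  obtain y where y: "is_image S ep mo x z y"
    using ic assms ar_carrier unfolding image_condition_def by blast
  then have xy: "(x, y) \<in> ep" "(y, z) \<in> mo"
    by (auto simp: is_image_def minimal_in_def factorizations_def)
  have "minimal_in ep (F_set S mo z) y"
    unfolding minimal_in_def
  proof (intro conjI notI)
    show "y \<in> F_set S mo z" using xy mo_carrier by (auto simp: F_set_def)
    assume "\<exists>x'\<in>F_set S mo z - {y}. (y, x') \<in> ep"
    then obtain x' where "x' \<noteq> y" "(x', z) \<in> mo" "(y, x') \<in> ep" by (auto simp: F_set_def)
    with y ep_trans[OF xy(1)] ep_carrier show False
      unfolding is_image_def minimal_in_def factorizations_def by blast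
  qed
  then have "(y, z) \<in> squig S ep mo" using xy mo_carrier by (auto simp: squig_def)
  with xy y that show thesis by blast
qed

text \<open>Dual of \<open>image_exists\<close>, with one shift: a co-image is maximal in
  \<open>T(x)\<close>, so it is related by \<open>squig\<close> to the source \<open>x\<close>
  instead of the target.\<close>

lemma coimage_exists:
  assumes "(x, z) \<in> ar"
  obtains y where "(x, y) \<in> ep" "(y, z) \<in> mo" "(y, x) \<in> squig S ep mo" "is_coimage S ep mo x z y"
proof -
  obtain y where y: "is_coimage S ep mo x z y"
    using ic assms ar_carrier unfolding image_condition_def by blast
  then have xy: "(x, y) \<in> ep" "(y, z) \<in> mo"
    by (auto simp: is_coimage_def maximal_in_def factorizations_def)
  have "maximal_in mo (T_set S ep x) y"
    unfolding maximal_in_def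
  proof (intro conjI notI)
    show "y \<in> T_set S ep x" using xy ep_carrier by (auto simp: T_set_def)
    assume "\<exists>x'\<in>T_set S ep x - {y}. (x', y) \<in> mo"
    then obtain x' where "x' \<noteq> y" "(x, x') \<in> ep" "(x', y) \<in> mo" by (auto simp: T_set_def)
    with y mo_trans[OF _ xy(2)] mo_carrier show False
      unfolding is_coimage_def maximal_in_def factorizations_def by blast
  qed
  then have "(y, x) \<in> squig S ep mo" using xy ep_carrier by (auto simp: squig_def)
  with xy y that show thesis by blast
qed

text \<open>Some arrow from \<open>x\<close> ends in \<open>snd p\<close>, and its middle factor
  stays there because \<open>snd p\<close> is closed under \<open>mo\<close>-predecessors.\<close>

lemma ep_into_snd:
  assumes "p \<in> carrier \<P>" "x \<in> S" "x \<notin> fst p"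
  obtains w where "w \<in> snd p" "(x, w) \<in> ep"
  using assms mem_fst_iff[of p S ar x] ar_iff[of x] snd_mo_closed by blast

text \<open>Taking a co-image as the middle factor makes the witness one that every upset containing
  \<open>x\<close> contains.\<close>

lemma ep_into_snd_squig:
  assumes "p \<in> carrier \<P>" "x \<in> S" "x \<notin> fst p"
  obtains w where "w \<in> snd p" "(x, w) \<in> ep" "(w, x) \<in> squig S ep mo"
proof -
  obtain z where z: "z \<in> snd p" "(x, z) \<in> ar" using assms mem_fst_iff by metis
  then show thesis using that coimage_exists snd_mo_closed assms(1) by metis
qed

lemma mo_from_fst_squig:
  assumes "p \<in> carrier \<P>" "y \<in> S" "y \<notin> snd p"
  obtains w where "w \<in> fst p" "(w, y) \<in> mo" "(w, y) \<in> squig S ep mo"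
proof -
  obtain z where z: "z \<in> fst p" "(z, y) \<in> ar" using assms mem_snd_iff by metis
  then show thesis using that image_exists fst_ep_closed assms(1) by metis
qed

subsection \<open>Irreducible pairs and covers\<close>

definition jirr where "jirr c = (T_set S ep c, rperp S ar (T_set S ep c))"
definition jirr_lower where "jirr_lower c = (T_set S ep c - {c}, rperp S ar (T_set S ep c - {c}))"
definition mirr where "mirr c = (lperp S ar (F_set S mo c), F_set S mo c)"
definition mirr_upper where "mirr_upper c = (lperp S ar (F_set S mo c - {c}), F_set S mo c - {c})"

lemma fst_jirr: "x \<in> fst (jirr c) \<longleftrightarrow> (c, x) \<in> ep"
  and fst_jirr_lower: "x \<in> fst (jirr_lower c) \<longleftrightarrow> (c, x) \<in> ep \<and> x \<noteq> c"
  and snd_mirr: "x \<in> snd (mirr c) \<longleftrightarrow> (x, c) \<in> mo"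
  and snd_mirr_upper: "x \<in> snd (mirr_upper c) \<longleftrightarrow> (x, c) \<in> mo \<and> x \<noteq> c"
  using ep_carrier mo_carrier
  by (auto simp: jirr_def jirr_lower_def mirr_def mirr_upper_def T_set_def F_set_def)

text \<open>Every arrow out of an element of \<open>T(c)\<close> gives an arrow out of
  \<open>c\<close>, so orthogonality to \<open>T(c)\<close> is orthogonality to \<open>c\<close>
  alone; dually for \<open>F(c)\<close>.\<close>

lemma snd_jirr: "c \<in> S \<Longrightarrow> x \<in> snd (jirr c) \<longleftrightarrow> x \<in> S \<and> (c, x) \<notin> ar"
  and fst_mirr: "c \<in> S \<Longrightarrow> x \<in> fst (mirr c) \<longleftrightarrow> x \<in> S \<and> (x, c) \<notin> ar"
  using ep_ar_trans ar_mo_trans ep_refl mo_refl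
  by (auto simp: jirr_def mirr_def T_set_def F_set_def rperp_def lperp_def)

text \<open>\<open>z\<close> lies in the right perp of \<open>A\<close> and witnesses that
  \<open>x\<close> is not in the double perp, so the double perp adds nothing to
  \<open>A\<close>.\<close>

lemma rperp_pairI:
  assumes "A \<subseteq> S" "\<And>x. x \<in> S \<Longrightarrow> x \<notin> A \<Longrightarrow> \<exists>z\<in>S. (x, z) \<in> ar \<and> (\<forall>a\<in>A. (a, z) \<notin> ar)"
  shows "(A, rperp S ar A) \<in> carrier \<P>"
proof -
  have "lperp S ar (rperp S ar A) = A"
    using assms unfolding lperp_def rperp_def by blast
  then show ?thesis by (simp add: mem_Pairs)
qed

lemma lperp_pairI:
  assumes "B \<subseteq> S" "\<And>y. y \<in> S \<Longrightarrow> y \<notin> B \<Longrightarrow> \<exists>z\<in>S. (z, y) \<in> ar \<and> (\<forall>b\<in>B. (z, b) \<notin> ar)"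
  shows "(lperp S ar B, B) \<in> carrier \<P>"
proof -
  have "rperp S ar (lperp S ar B) = B"
    using assms unfolding lperp_def rperp_def by blast
  then show ?thesis by (simp add: mem_Pairs)
qed

lemma
  assumes c: "c \<in> S"
  shows jirr_closed: "jirr c \<in> carrier \<P>" and jirr_lower_closed: "jirr_lower c \<in> carrier \<P>"
proof -
  \<comment> \<open>Failure of \<open>c\<close> reaching \<open>x\<close> by \<open>ep\<close>
    supplies, by the definition of \<open>ep\<close>, an arrow out of \<open>x\<close> that
    \<open>c\<close> lacks.\<close>
  have *: "\<exists>z\<in>S. (x, z) \<in> ar \<and> (\<forall>a\<in>T_set S ep c. (a, z) \<notin> ar)" if x: "x \<in> S" "x \<notin> T_set S ep c" for x
  proof -
    obtain z where "(x, z) \<in> ar" "(c, z) \<notin> ar"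
      using x c ep_iff[of c x] unfolding T_set_def by blast
    then show ?thesis using ar_carrier ep_ar_trans by (auto simp: T_set_def)
  qed
  then show "jirr c \<in> carrier \<P>"
    unfolding jirr_def by (intro rperp_pairI) (auto simp: T_set_def)
  \<comment> \<open>For the lower cover one more element, \<open>c\<close>, must be separated. It
    separates itself: an arrow back from another element of \<open>T(c)\<close> would be a
    cycle.\<close>
  have "(c, c) \<in> ar \<and> (\<forall>a\<in>T_set S ep c - {c}. (a, c) \<notin> ar)"
    using ar_refl[OF c] ep_ar_cycle by (auto simp: T_set_def)
  with * c show "jirr_lower c \<in> carrier \<P>"
    unfolding jirr_lower_def by (intro rperp_pairI) (simp add: T_set_def subset_iff, blast)
qed

lemma
  assumes c: "c \<in> S"
  shows mirr_closed: "mirr c \<in> carrier \<P>" and mirr_upper_closed: "mirr_upper c \<in> carrier \<P>"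
proof -
  have *: "\<exists>z\<in>S. (z, x) \<in> ar \<and> (\<forall>a\<in>F_set S mo c. (z, a) \<notin> ar)" if x: "x \<in> S" "x \<notin> F_set S mo c" for x
  proof -
    obtain z where "(z, x) \<in> ar" "(z, c) \<notin> ar"
      using x c mo_iff[of x c] unfolding F_set_def by blast
    then show ?thesis using ar_carrier ar_mo_trans by (auto simp: F_set_def)
  qed
  then show "mirr c \<in> carrier \<P>"
    unfolding mirr_def by (intro lperp_pairI) (auto simp: F_set_def)
  have "(c, c) \<in> ar \<and> (\<forall>a\<in>F_set S mo c - {c}. (c, a) \<notin> ar)"
    using ar_refl[OF c] ar_mo_cycle by (auto simp: F_set_def)
  with * c show "mirr_upper c \<in> carrier \<P>"
    unfolding mirr_upper_def by (intro lperp_pairI) (simp add: F_set_def subset_iff, blast)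
qed

text \<open>The cover is built from the label: join \<open>p\<close> with \<open>jirr c\<close>,
  then meet the result with \<open>mirr c\<close>. Anything strictly above \<open>u\<close> and
  below \<open>v\<close> is shown to contain \<open>c\<close>, hence to be \<open>v\<close>.\<close>

lemma cover_between:
  assumes p: "p \<in> carrier \<P>" and q: "q \<in> carrier \<P>" and le: "fst p \<subseteq> fst q"
    and c: "c \<in> fst q" "c \<in> snd p"
  obtains u v where "covered_by \<P> u v" "fst p \<subseteq> fst u" "fst v \<subseteq> fst q" "c \<in> fst v" "c \<in> snd u"
proof -
  have cS: "c \<in> S" using c fst_subset[OF q] by blast
  define v where "v = p \<squnion>\<^bsub>\<P>\<^esub> jirr c"
  define u where "u = v \<sqinter>\<^bsub>\<P>\<^esub> mirr c"
  have v: "v \<in> carrier \<P>" and sv: "snd v = snd p \<inter> snd (jirr c)"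
    unfolding v_def by (simp_all add: p jirr_closed[OF cS] join_Pairs_closed snd_join_Pairs)
  have u: "u \<in> carrier \<P>" and fu: "fst u = fst v \<inter> fst (mirr c)"
    unfolding u_def by (simp_all add: v mirr_closed[OF cS] meet_Pairs_closed fst_meet_Pairs)
  have pv: "fst p \<subseteq> fst v" using fst_subset_iff_snd_subset[OF p v] sv by blast
  have "fst (jirr c) \<subseteq> fst v"
    using fst_subset_iff_snd_subset[OF jirr_closed[OF cS] v] sv by blast
  then have cv: "c \<in> fst v" using fst_jirr ep_refl[OF cS] by blast
  have "snd q \<subseteq> snd v"
    using fst_subset_iff_snd_subset[OF p q] le c mem_snd_iff[OF q] snd_jirr[OF cS] sv by blast
  then have vq: "fst v \<subseteq> fst q" using fst_subset_iff_snd_subset[OF v q] by blast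
  have pu: "fst p \<subseteq> fst u"
    using pv fu fst_mirr[OF cS] c(2) mem_snd_iff[OF p] fst_subset[OF p] by blast
  have cu: "c \<in> snd u"
    using mem_snd_iff[OF u] cS fu fst_mirr[OF cS] by blast
  have "w = v" if w: "w \<in> carrier \<P>" "fst u \<subseteq> fst w" "u \<noteq> w" "fst w \<subseteq> fst v" for w
  proof -
    obtain x where x: "x \<in> fst w" "x \<notin> fst u" using w Pairs_eqI1[OF u w(1)] by blast
    \<comment> \<open>Within \<open>v\<close>, only the constraint from \<open>mirr c\<close> can
      keep \<open>x\<close> out of \<open>u\<close>.\<close>
    have "(x, c) \<in> ar" using x w fu fst_mirr[OF cS] fst_subset[OF w(1)] by blast
    then obtain b where b: "(x, b) \<in> ep" "(b, c) \<in> mo" using ar_iff by blast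
    have bw: "b \<in> fst w" using fst_ep_closed[OF w(1) x(1) b(1)] .
    then have "b \<notin> snd v" using w(4) fst_snd_disjoint[OF v] by blast
    \<comment> \<open>\<open>b\<close> lies in \<open>snd p\<close>, so its absence from
      \<open>snd v\<close> can only come from the factor \<open>snd (jirr c)\<close>. The resulting
      arrow closes a cycle with \<open>mo\<close> and identifies \<open>b\<close> with
      \<open>c\<close>.\<close>
    then have "(c, b) \<in> ar"
      using sv snd_jirr[OF cS] snd_mo_closed[OF p c(2) b(2)] mo_carrier[OF b(2)] by blast
    then have cw: "c \<in> fst w" using ar_mo_cycle[OF _ b(2)] bw by blast
    have "snd w \<subseteq> snd v"
    proof
      fix y assume y: "y \<in> snd w"
      then have "y \<in> snd p" using fst_subset_iff_snd_subset[OF p w(1)] pu w(2) by blast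
      then show "y \<in> snd v" using y cw mem_snd_iff[OF w(1)] sv snd_jirr[OF cS] by blast
    qed
    then have "fst v \<subseteq> fst w" using fst_subset_iff_snd_subset[OF v w(1)] by blast
    with w(4) show ?thesis using Pairs_eqI1[OF w(1) v] by blast
  qed
  moreover have "u \<noteq> v" using cu cv fst_snd_disjoint[OF u] by blast
  ultimately have "covered_by \<P> u v"
    using u v fu unfolding covered_by_def Pairs_simps by blast
  then show thesis using that pu vq cv cu by blast
qed

section \<open>Contracted elements of a congruence\<close>

lemma fst_jirr_subset:
  assumes "p \<in> carrier \<P>"
  shows "fst (jirr c) \<subseteq> fst p \<longleftrightarrow> c \<in> fst p \<or> c \<notin> S"
  using fst_ep_closed[OF assms] fst_jirr ep_refl ep_carrier by blast

text \<open>Among the elements of \<open>T(c)\<close> only \<open>c\<close> has an arrow to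
  \<open>c\<close>, so meeting with \<open>mirr c\<close> removes exactly \<open>c\<close>. Together
  with the dual lemma this makes the cover below \<open>jirr c\<close> perspective to the one above
  \<open>mirr c\<close>.\<close>

lemma jirr_lower_meet_mirr:
  assumes c: "c \<in> S"
  shows "jirr c \<sqinter>\<^bsub>\<P>\<^esub> mirr c = jirr_lower c"
proof (rule Pairs_eqI1[of _ S ar])
  show "fst (jirr c \<sqinter>\<^bsub>\<P>\<^esub> mirr c) = fst (jirr_lower c)"
    unfolding fst_meet_Pairs[OF jirr_closed[OF c] mirr_closed[OF c]]
  proof (rule Set.set_eqI)
    show "x \<in> fst (jirr c) \<inter> fst (mirr c) \<longleftrightarrow> x \<in> fst (jirr_lower c)" for x
      unfolding Int_iff fst_jirr fst_mirr[OF c] fst_jirr_lower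
      using ep_ar_cycle ar_refl[OF c] ep_carrier by metis
  qed
qed (simp_all add: c jirr_closed mirr_closed jirr_lower_closed meet_Pairs_closed)

lemma mirr_join_jirr:
  assumes c: "c \<in> S"
  shows "mirr c \<squnion>\<^bsub>\<P>\<^esub> jirr c = mirr_upper c"
proof (rule Pairs_eqI2[of _ S ar])
  show "snd (mirr c \<squnion>\<^bsub>\<P>\<^esub> jirr c) = snd (mirr_upper c)"
    unfolding snd_join_Pairs[OF mirr_closed[OF c] jirr_closed[OF c]]
  proof (rule Set.set_eqI)
    show "x \<in> snd (mirr c) \<inter> snd (jirr c) \<longleftrightarrow> x \<in> snd (mirr_upper c)" for x
      unfolding Int_iff snd_jirr[OF c] snd_mirr snd_mirr_upper
      using ar_mo_cycle ar_refl[OF c] mo_carrier by metis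
  qed
qed (simp_all add: c jirr_closed mirr_closed mirr_upper_closed join_Pairs_closed)

definition contracted where "contracted \<Theta> c \<longleftrightarrow> (jirr_lower c, jirr c) \<in> \<Theta>"

text \<open>Meeting with \<open>jirr c\<close> turns \<open>q\<close> into \<open>jirr c\<close> and
  pushes \<open>p\<close> below \<open>jirr_lower c\<close>, as \<open>c\<close> is not in
  \<open>fst p\<close>; joining with \<open>jirr_lower c\<close> then lands exactly on the
  cover.\<close>

lemma congruent_imp_contracted:
  assumes cong: "lattice_congruence \<P> \<Theta>"
    and p: "p \<in> carrier \<P>" and q: "q \<in> carrier \<P>" and pq: "(p, q) \<in> \<Theta>"
    and c: "c \<in> fst q" "c \<in> snd p"
  shows "contracted \<Theta> c"
proof -
  have cS: "c \<in> S" using c fst_subset[OF q] by blast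
  note [simp] = p q jirr_closed[OF cS] jirr_lower_closed[OF cS] meet_Pairs_closed join_Pairs_closed
  have "(p \<sqinter>\<^bsub>\<P>\<^esub> jirr c, q \<sqinter>\<^bsub>\<P>\<^esub> jirr c) \<in> \<Theta>"
    by (rule lattice_congruence_meet[OF cong pq]) simp
  also have "q \<sqinter>\<^bsub>\<P>\<^esub> jirr c = jirr c"
    by (rule meet_absorb) (use c(1) fst_jirr_subset[OF q] in simp_all)
  finally have *: "(p \<sqinter>\<^bsub>\<P>\<^esub> jirr c, jirr c) \<in> \<Theta>" .
  have "c \<notin> fst p" using c(2) fst_snd_disjoint[OF p] by blast
  then have "fst (p \<sqinter>\<^bsub>\<P>\<^esub> jirr c) \<subseteq> fst (jirr_lower c)"
    using fst_jirr fst_jirr_lower by (simp add: fst_meet_Pairs) blast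
  then have "(p \<sqinter>\<^bsub>\<P>\<^esub> jirr c) \<squnion>\<^bsub>\<P>\<^esub> jirr_lower c = jirr_lower c"
    by (intro join_absorb) simp_all
  moreover have "jirr c \<squnion>\<^bsub>\<P>\<^esub> jirr_lower c = jirr c"
    by (rule join_absorb) (use fst_jirr fst_jirr_lower in \<open>simp, simp, blast\<close>)
  ultimately show ?thesis
    using lattice_congruence_join[OF cong *, of "jirr_lower c"] by (simp add: contracted_def)
qed

text \<open>Joining with \<open>mirr c\<close> transports the contracted cover along the
  perspectivity, so that contraction can also be exploited through meet-irreducibles.\<close>

lemma contracted_imp_mirr:
  assumes cong: "lattice_congruence \<P> \<Theta>" and c: "c \<in> S" "contracted \<Theta> c"
  shows "(mirr c, mirr_upper c) \<in> \<Theta>"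
proof -
  note [simp] = jirr_closed[OF c(1)] jirr_lower_closed[OF c(1)] mirr_closed[OF c(1)]
    mirr_upper_closed[OF c(1)] meet_Pairs_closed join_Pairs_closed
  have "(jirr_lower c \<squnion>\<^bsub>\<P>\<^esub> mirr c, jirr c \<squnion>\<^bsub>\<P>\<^esub> mirr c) \<in> \<Theta>"
    by (rule lattice_congruence_join[OF cong]) (use c(2) contracted_def in simp_all)
  also have "jirr_lower c \<squnion>\<^bsub>\<P>\<^esub> mirr c = mirr c"
    by (rule join_absorb)
      (simp_all add: fst_meet_Pairs flip: jirr_lower_meet_mirr[OF c(1)])
  finally have "(mirr c, jirr c \<squnion>\<^bsub>\<P>\<^esub> mirr c) \<in> \<Theta>" .
  also have "jirr c \<squnion>\<^bsub>\<P>\<^esub> mirr c = mirr_upper c"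
    by (simp add: join_def insert_commute flip: mirr_join_jirr[OF c(1)])
  finally show ?thesis .
qed

text \<open>Join the contracted cover below \<open>jirr c\<close> with \<open>u\<close>. Both
  results lie between \<open>u\<close> and \<open>v\<close>, and the position of \<open>c\<close>
  decides which end each one equals.\<close>

lemma cover_congruentI:
  assumes cong: "lattice_congruence \<P> \<Theta>" and cover: "covered_by \<P> u v"
    and c: "c \<in> fst v" "c \<in> snd u" "contracted \<Theta> c"
  shows "(u, v) \<in> \<Theta>"
proof -
  have u: "u \<in> carrier \<P>" and v: "v \<in> carrier \<P>" and uv: "fst u \<subseteq> fst v"
    using cover unfolding covered_by_def Pairs_simps by blast+
  have between: "w = u \<or> w = v" if "w \<in> carrier \<P>" "fst u \<subseteq> fst w" "fst w \<subseteq> fst v" for w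
    using that cover unfolding covered_by_def Pairs_simps by metis
  have cS: "c \<in> S" using c fst_subset[OF v] by blast
  note closed = u v jirr_closed[OF cS] jirr_lower_closed[OF cS]
  have jv: "fst (jirr c) \<subseteq> fst v" using fst_jirr_subset[OF v] c(1) by blast
  then have jlv: "fst (jirr_lower c) \<subseteq> fst v" using fst_jirr fst_jirr_lower by blast
  have "c \<in> fst (jirr c \<squnion>\<^bsub>\<P>\<^esub> u)"
    using fst_join_upper(1)[OF closed(3) u] fst_jirr ep_refl[OF cS] by blast
  then have "jirr c \<squnion>\<^bsub>\<P>\<^esub> u \<noteq> u" using c(2) fst_snd_disjoint[OF u] by metis
  then have "jirr c \<squnion>\<^bsub>\<P>\<^esub> u = v"
    using between[of "jirr c \<squnion>\<^bsub>\<P>\<^esub> u"] closed jv uv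
    by (meson join_Pairs_closed fst_join_upper(2) fst_join_least)
  moreover have "c \<in> snd (jirr_lower c)"
    using mem_snd_iff[OF closed(4)] cS fst_jirr_lower ep_ar_cycle by metis
  then have "c \<in> snd (jirr_lower c \<squnion>\<^bsub>\<P>\<^esub> u)"
    using c(2) by (simp add: snd_join_Pairs closed)
  then have "jirr_lower c \<squnion>\<^bsub>\<P>\<^esub> u \<noteq> v" using c(1) fst_snd_disjoint[OF v] by metis
  then have "jirr_lower c \<squnion>\<^bsub>\<P>\<^esub> u = u"
    using between[of "jirr_lower c \<squnion>\<^bsub>\<P>\<^esub> u"] closed jlv uv
    by (meson join_Pairs_closed fst_join_upper(2) fst_join_least)
  ultimately show ?thesis
    using lattice_congruence_join[OF cong c(3)[unfolded contracted_def] u] by simp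
qed

text \<open>Joining both sides of the cover for \<open>x\<close> with \<open>jirr_lower y\<close>
  gives congruent pairs \<open>?A\<close> and \<open>?B\<close>. Passing from \<open>?A\<close> to
  \<open>?B\<close> moves \<open>y\<close> from the second component to the first, so
  \<open>congruent_imp_contracted\<close> applies to \<open>y\<close>.\<close>

lemma contracted_minimal:
  assumes cong: "lattice_congruence \<P> \<Theta>" and x: "contracted \<Theta> x"
    and min: "minimal_in ep (F_set S mo y) x"
  shows "contracted \<Theta> y"
proof -
  have xy: "(x, y) \<in> mo" using min by (simp add: minimal_in_def F_set_def)
  have minD: "w = x" if "(x, w) \<in> ep" "(w, y) \<in> mo" for w
    using min that mo_carrier by (auto simp: minimal_in_def F_set_def)
  have xS: "x \<in> S" and yS: "y \<in> S" using xy mo_carrier by blast+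
  note closed = jirr_closed[OF xS] jirr_lower_closed[OF xS] jirr_closed[OF yS] jirr_lower_closed[OF yS]
  note [simp] = closed meet_Pairs_closed join_Pairs_closed
  let ?A = "jirr_lower x \<squnion>\<^bsub>\<P>\<^esub> jirr_lower y" and ?B = "jirr x \<squnion>\<^bsub>\<P>\<^esub> jirr_lower y"
  have "(?A, ?B) \<in> \<Theta>"
    by (rule lattice_congruence_join[OF cong x[unfolded contracted_def]]) simp
  \<comment> \<open>An arrow from \<open>y\<close> to \<open>z\<close> factors through some
    \<open>w\<close>. If \<open>w = y\<close>, then \<open>x\<close> has an arrow to
    \<open>z\<close>; otherwise \<open>w\<close> is in the first component of
    \<open>jirr_lower y\<close>. Either way \<open>z\<close> is not in
    \<open>snd ?B\<close>.\<close>
  moreover have "y \<in> fst ?B"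
  proof -
    have False if z: "z \<in> snd (jirr x)" "z \<in> snd (jirr_lower y)" "(y, z) \<in> ar" for z
    proof -
      obtain w where w: "(y, w) \<in> ep" "(w, z) \<in> mo" using z(3) ar_iff by blast
      show False
      proof (cases "w = y")
        case True
        then have "(x, z) \<in> ar" using w xy mo_trans mo_imp_ar by blast
        then show False using z(1) snd_jirr[OF xS] by blast
      next
        case False
        then show False
          using w z(2) mem_snd_iff[OF closed(4)] fst_jirr_lower mo_imp_ar by blast
      qed
    qed
    then show ?thesis
      using mem_fst_iff[of ?B S ar y] yS by (auto simp: snd_join_Pairs)
  qed
  moreover have "y \<in> snd ?A"
  proof -
    \<comment> \<open>Here minimality enters: the middle factor of such an arrow would have to be
      \<open>x\<close>, giving an \<open>ep\<close>-cycle between \<open>x\<close> and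
      \<open>w\<close>.\<close>
    have "(w, y) \<notin> ar" if w: "(x, w) \<in> ep" "w \<noteq> x" for w
    proof
      assume "(w, y) \<in> ar"
      then obtain b where b: "(w, b) \<in> ep" "(b, y) \<in> mo" using ar_iff by blast
      then have "b = x" using minD w ep_trans by blast
      then show False using b w ep_antisym by blast
    qed
    then have "y \<in> snd (jirr_lower x)"
      using yS mem_snd_iff[OF closed(2)] fst_jirr_lower by blast
    moreover have "y \<in> snd (jirr_lower y)"
      using yS mem_snd_iff[OF closed(4)] fst_jirr_lower ep_ar_cycle by blast
    ultimately show ?thesis by (simp add: snd_join_Pairs)
  qed
  ultimately show ?thesis
    by (intro congruent_imp_contracted[OF cong, of ?A ?B]) simp_all
qed

text \<open>Dual argument on the meet side: the cover above \<open>mirr x\<close>, contracted by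
  \<open>contracted_imp_mirr\<close>, is met with \<open>mirr_upper y\<close>.\<close>

lemma contracted_maximal:
  assumes cong: "lattice_congruence \<P> \<Theta>" and x: "contracted \<Theta> x"
    and max: "maximal_in mo (T_set S ep y) x"
  shows "contracted \<Theta> y"
proof -
  have yx: "(y, x) \<in> ep" using max by (simp add: maximal_in_def T_set_def)
  have maxD: "w = x" if "(w, x) \<in> mo" "(y, w) \<in> ep" for w
    using max that ep_carrier by (auto simp: maximal_in_def T_set_def)
  have xS: "x \<in> S" and yS: "y \<in> S" using yx ep_carrier by blast+
  note closed = mirr_closed[OF xS] mirr_upper_closed[OF xS] mirr_closed[OF yS] mirr_upper_closed[OF yS]
  note [simp] = closed meet_Pairs_closed join_Pairs_closed
  let ?A = "mirr x \<sqinter>\<^bsub>\<P>\<^esub> mirr_upper y" and ?B = "mirr_upper x \<sqinter>\<^bsub>\<P>\<^esub> mirr_upper y"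
  have "(?A, ?B) \<in> \<Theta>"
    by (rule lattice_congruence_meet[OF cong contracted_imp_mirr[OF cong xS x]]) simp
  moreover have "y \<in> snd ?A"
  proof -
    have False if z: "z \<in> fst (mirr x)" "z \<in> fst (mirr_upper y)" "(z, y) \<in> ar" for z
    proof -
      obtain w where w: "(z, w) \<in> ep" "(w, y) \<in> mo" using z(3) ar_iff by blast
      show False
      proof (cases "w = y")
        case True
        then have "(z, x) \<in> ar" using w yx ep_trans ep_imp_ar by blast
        then show False using z(1) fst_mirr[OF xS] by blast
      next
        case False
        then show False
          using w z(2) mem_fst_iff[OF closed(4)] snd_mirr_upper ep_imp_ar by blast
      qed
    qed
    then show ?thesis
      using mem_snd_iff[of ?A S ar y] yS by (auto simp: fst_meet_Pairs)
  qed
  moreover have "y \<in> fst ?B"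
  proof -
    have "(y, w) \<notin> ar" if w: "(w, x) \<in> mo" "w \<noteq> x" for w
    proof
      assume "(y, w) \<in> ar"
      then obtain b where b: "(y, b) \<in> ep" "(b, w) \<in> mo" using ar_iff by blast
      then have "b = x" using maxD w mo_trans by blast
      then show False using b w mo_antisym by blast
    qed
    then have "y \<in> fst (mirr_upper x)"
      using yS mem_fst_iff[OF closed(2)] snd_mirr_upper by blast
    moreover have "y \<in> fst (mirr_upper y)"
      using yS mem_fst_iff[OF closed(4)] snd_mirr_upper ar_mo_cycle by blast
    ultimately show ?thesis by (simp add: fst_meet_Pairs)
  qed
  ultimately show ?thesis
    by (intro congruent_imp_contracted[OF cong, of ?A ?B]) simp_all
qed

lemma squig_upset_noncontracted:
  assumes "lattice_congruence \<P> \<Theta>"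
  shows "squig_upset S ep mo {c \<in> S. \<not> contracted \<Theta> c}"
  unfolding squig_upset_def
proof (intro conjI allI impI; (elim conjE)?)
  fix x y assume "(x, y) \<in> squig S ep mo" "y \<in> {c \<in> S. \<not> contracted \<Theta> c}"
  then have "x \<in> S" "\<not> contracted \<Theta> y"
    and "minimal_in ep (F_set S mo y) x \<or> maximal_in mo (T_set S ep y) x"
    by (simp_all add: squig_def)
  then show "x \<in> {c \<in> S. \<not> contracted \<Theta> c}"
    using contracted_minimal[OF assms, of x y] contracted_maximal[OF assms, of x y] by blast
qed blast

section \<open>Restriction to upsets\<close>

context
  fixes C
  assumes C: "squig_upset S ep mo C"
begin

lemma upset_subset: "C \<subseteq> S"
  and upset_closed: "(x, y) \<in> squig S ep mo \<Longrightarrow> y \<in> C \<Longrightarrow> x \<in> C"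
  using C by (auto simp: squig_upset_def)

text \<open>Testing against \<open>C\<close> suffices: an arrow from \<open>y\<close> to any
  \<open>z\<close> passes through a co-image, which lies in \<open>C\<close> with \<open>y\<close>,
  and composing with \<open>mo\<close> recovers the arrow to \<open>z\<close>. The lemma for
  \<open>mo\<close> uses images instead.\<close>

lemma Restr_ep_iff:
  assumes "x \<in> C" "y \<in> C"
  shows "(x, y) \<in> ep \<longleftrightarrow> (\<forall>z\<in>C. (y, z) \<in> ar \<longrightarrow> (x, z) \<in> ar)"
proof
  assume *: "\<forall>z\<in>C. (y, z) \<in> ar \<longrightarrow> (x, z) \<in> ar"
  have "(x, z) \<in> ar" if z: "(y, z) \<in> ar" for z
  proof -
    obtain w where "(y, w) \<in> ep" "(w, z) \<in> mo" "(w, y) \<in> squig S ep mo"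
      using coimage_exists[OF z] by blast
    then show ?thesis
      using * upset_closed[OF _ assms(2)] ep_imp_ar ar_mo_trans by blast
  qed
  then show "(x, y) \<in> ep" using assms upset_subset ep_iff by blast
qed (simp add: ep_iff)

lemma Restr_mo_iff:
  assumes "x \<in> C" "y \<in> C"
  shows "(x, y) \<in> mo \<longleftrightarrow> (\<forall>z\<in>C. (z, x) \<in> ar \<longrightarrow> (z, y) \<in> ar)"
proof
  assume *: "\<forall>z\<in>C. (z, x) \<in> ar \<longrightarrow> (z, y) \<in> ar"
  have "(z, y) \<in> ar" if z: "(z, x) \<in> ar" for z
  proof -
    obtain w where "(z, w) \<in> ep" "(w, x) \<in> mo" "(w, x) \<in> squig S ep mo"
      using image_exists[OF z] by blast
    then show ?thesis
      using * upset_closed[OF _ assms(1)] mo_imp_ar ep_ar_trans by blast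
  qed
  then show "(x, y) \<in> mo" using assms upset_subset mo_iff by blast
qed (simp add: mo_iff)

lemma factorization_system_Restr: "factorization_system C (Restr ar C) (Restr ep C) (Restr mo C)"
  unfolding factorization_system_def
proof (intro conjI)
  show "refl_on C (Restr ar C)"
    using ar_refl upset_subset by (auto simp: refl_on_def)
  show "Fact C (Restr ar C) = (Restr ep C, Restr mo C)"
    by (auto simp: Fact_def Restr_ep_iff Restr_mo_iff)
  show "Mult C (Restr ep C) (Restr mo C) = Restr ar C"
  proof
    show "Mult C (Restr ep C) (Restr mo C) \<subseteq> Restr ar C"
      using ar_iff by (auto simp: Mult_def)
    show "Restr ar C \<subseteq> Mult C (Restr ep C) (Restr mo C)"
    proof clarify
      fix x z assume xz: "(x, z) \<in> ar" "x \<in> C" "z \<in> C"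
      \<comment> \<open>An image is a middle factor that is forced into \<open>C\<close> by its
        target \<open>z\<close>.\<close>
      then obtain w where "(x, w) \<in> ep" "(w, z) \<in> mo" "(w, z) \<in> squig S ep mo"
        using image_exists by blast
      then show "(x, z) \<in> Mult C (Restr ep C) (Restr mo C)"
        using xz upset_closed by (auto simp: Mult_def)
    qed
  qed
qed auto

lemma two_acyclic_Restr: "two_acyclic (Restr ep C) (Restr mo C)"
  using ta by (auto simp: two_acyclic_def)

text \<open>The image and co-image found in \<open>S\<close> already lie in \<open>C\<close>, and
  they stay extremal among the fewer factorizations through \<open>C\<close>.\<close>

lemma image_condition_Restr: "image_condition C (Restr ar C) (Restr ep C) (Restr mo C)"
  unfolding image_condition_def
proof (intro ballI impI conjI)
  fix x z assume x: "x \<in> C" and z: "z \<in> C" and "(x, z) \<in> Restr ar C"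
  then have xz: "(x, z) \<in> ar" by simp
  show "\<exists>y. is_image C (Restr ep C) (Restr mo C) x z y"
  proof -
    obtain y where y: "(y, z) \<in> squig S ep mo" "is_image S ep mo x z y"
      using image_exists[OF xz] by blast
    then have "y \<in> C" using upset_closed z by blast
    with y(2) x z upset_subset have "is_image C (Restr ep C) (Restr mo C) x z y"
      by (auto simp: is_image_def minimal_in_def factorizations_def)
    then show ?thesis ..
  qed
  show "\<exists>y. is_coimage C (Restr ep C) (Restr mo C) x z y"
  proof -
    obtain y where y: "(y, x) \<in> squig S ep mo" "is_coimage S ep mo x z y"
      using coimage_exists[OF xz] by blast
    then have "y \<in> C" using upset_closed x by blast
    with y(2) x z upset_subset have "is_coimage C (Restr ep C) (Restr mo C) x z y"
      by (auto simp: is_coimage_def maximal_in_def factorizations_def)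
    then show ?thesis ..
  qed
qed

lemma fst_restrict_pair: "fst (restrict_pair C p) = fst p \<inter> C"
  and snd_restrict_pair: "snd (restrict_pair C p) = snd p \<inter> C"
  by (simp_all add: restrict_pair_def case_prod_unfold)

text \<open>Whenever an element of \<open>C\<close> fails to be orthogonal to a component, a witness
  for the failure can be found inside \<open>C\<close>.\<close>

lemma restrict_pair_closed:
  assumes p: "p \<in> carrier \<P>"
  shows "restrict_pair C p \<in> carrier (Pairs C (Restr ar C))"
  unfolding mem_Pairs fst_restrict_pair snd_restrict_pair
proof
  have "y \<in> snd p" if y: "y \<in> C" "\<forall>x\<in>fst p \<inter> C. (x, y) \<notin> ar" for y
  proof (rule ccontr)
    assume "y \<notin> snd p"
    then obtain w where "w \<in> fst p" "(w, y) \<in> mo" "(w, y) \<in> squig S ep mo"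
      using mo_from_fst_squig[OF p, of y] y(1) upset_subset by blast
    then show False using y upset_closed[of w y] mo_imp_ar[of w y] by blast
  qed
  then show "snd p \<inter> C = rperp C (Restr ar C) (fst p \<inter> C)"
    unfolding rperp_def using mem_snd_iff[OF p] by blast
  have "x \<in> fst p" if x: "x \<in> C" "\<forall>y\<in>snd p \<inter> C. (x, y) \<notin> ar" for x
  proof (rule ccontr)
    assume "x \<notin> fst p"
    then obtain w where "w \<in> snd p" "(x, w) \<in> ep" "(w, x) \<in> squig S ep mo"
      using ep_into_snd_squig[OF p, of x] x(1) upset_subset by blast
    then show False using x upset_closed[of w x] ep_imp_ar[of x w] by blast
  qed
  then show "fst p \<inter> C = lperp C (Restr ar C) (snd p \<inter> C)"
    unfolding lperp_def using mem_fst_iff[OF p] by blast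
qed

text \<open>A preimage is generated in \<open>S\<close> by the second component of \<open>q\<close>.
  Only first components need comparing, since the restriction is already known to be a pair.\<close>

lemma restrict_pair_surj: "restrict_pair C ` carrier \<P> = carrier (Pairs C (Restr ar C))"
proof
  show "carrier (Pairs C (Restr ar C)) \<subseteq> restrict_pair C ` carrier \<P>"
  proof
    fix q assume q: "q \<in> carrier (Pairs C (Restr ar C))"
    define p where "p = (lperp S ar (snd q), rperp S ar (lperp S ar (snd q)))"
    have p: "p \<in> carrier \<P>"
      unfolding p_def using snd_subset[OF q] upset_subset by (intro lperp_mem_Pairs) blast
    have "fst p \<inter> C = fst q"
      using mem_fst_iff[OF q] snd_subset[OF q] upset_subset unfolding p_def lperp_def fst_conv by blast
    then have "q = restrict_pair C p"
      by (intro Pairs_eqI1[OF q restrict_pair_closed[OF p]]) (simp add: fst_restrict_pair)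
    then show "q \<in> restrict_pair C ` carrier \<P>" using p by blast
  qed
qed (auto intro: restrict_pair_closed)

text \<open>Joins and meets are intersections of second and first components respectively, and these
  commute with intersecting with \<open>C\<close>.\<close>

lemma restrict_pair_hom: "complete_lattice_hom \<P> (Pairs C (Restr ar C)) (restrict_pair C)"
  unfolding complete_lattice_hom_def
proof (intro conjI allI impI)
  let ?Q = "Pairs C (Restr ar C)"
  show img: "restrict_pair C ` carrier \<P> \<subseteq> carrier ?Q" by (simp add: restrict_pair_surj)
  fix A assume A: "A \<subseteq> carrier \<P> \<and> A \<noteq> {}"
  then have A1: "A \<subseteq> carrier \<P>" and A2: "restrict_pair C ` A \<subseteq> carrier ?Q"
    using img by blast+
  show "restrict_pair C (\<Squnion>\<^bsub>\<P>\<^esub> A) = \<Squnion>\<^bsub>?Q\<^esub> (restrict_pair C ` A)"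
  proof (rule Pairs_eqI2[of _ C "Restr ar C"])
    show "snd (restrict_pair C (\<Squnion>\<^bsub>\<P>\<^esub> A)) = snd (\<Squnion>\<^bsub>?Q\<^esub> (restrict_pair C ` A))"
      using upset_subset unfolding snd_restrict_pair snd_Sup_Pairs[OF A1] snd_Sup_Pairs[OF A2] image_image
      by blast
  qed (simp_all add: restrict_pair_closed Sup_Pairs_closed A1 A2)
  show "restrict_pair C (\<Sqinter>\<^bsub>\<P>\<^esub> A) = \<Sqinter>\<^bsub>?Q\<^esub> (restrict_pair C ` A)"
  proof (rule Pairs_eqI1[of _ C "Restr ar C"])
    show "fst (restrict_pair C (\<Sqinter>\<^bsub>\<P>\<^esub> A)) = fst (\<Sqinter>\<^bsub>?Q\<^esub> (restrict_pair C ` A))"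
      using upset_subset unfolding fst_restrict_pair fst_Inf_Pairs[OF A1] fst_Inf_Pairs[OF A2] image_image
      by blast
  qed (simp_all add: restrict_pair_closed Inf_Pairs_closed A1 A2)
qed (rule complete_lattice_Pairs)+

lemma fiber_restrict_iff:
  assumes "p \<in> carrier \<P>" "q \<in> carrier \<P>"
  shows "(p, q) \<in> fiber_congruence \<P> (restrict_pair C) \<longleftrightarrow> fst p \<inter> C = fst q \<inter> C"
proof -
  have "restrict_pair C p = restrict_pair C q \<longleftrightarrow> fst p \<inter> C = fst q \<inter> C"
    using Pairs_eqI1[OF restrict_pair_closed[OF assms(1)] restrict_pair_closed[OF assms(2)]]
    by (metis fst_restrict_pair)
  with assms show ?thesis by (simp add: fiber_congruence_def)
qed

text \<open>An element \<open>c\<close> of \<open>C\<close> in \<open>fst q\<close> but not in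
  \<open>fst p\<close> reaches by \<open>ep\<close> some \<open>w\<close> in \<open>snd p\<close>
  with \<open>w \<leadsto> c\<close>. This \<open>w\<close> lies in \<open>C\<close> and, by
  closure, still in \<open>fst q\<close>.\<close>

lemma fiber_restrict_le_iff:
  assumes p: "p \<in> carrier \<P>" and q: "q \<in> carrier \<P>" and le: "fst p \<subseteq> fst q"
  shows "(p, q) \<in> fiber_congruence \<P> (restrict_pair C) \<longleftrightarrow> fst q \<inter> snd p \<inter> C = {}"
  unfolding fiber_restrict_iff[OF p q]
proof
  show "fst q \<inter> snd p \<inter> C = {}" if "fst p \<inter> C = fst q \<inter> C"
    using that fst_snd_disjoint[OF p] by blast
  show "fst p \<inter> C = fst q \<inter> C" if empty: "fst q \<inter> snd p \<inter> C = {}"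
  proof -
    have "c \<in> fst p" if c: "c \<in> fst q" "c \<in> C" for c
    proof (rule ccontr)
      assume "c \<notin> fst p"
      then obtain w where "w \<in> snd p" "(c, w) \<in> ep" "(w, c) \<in> squig S ep mo"
        using ep_into_snd_squig[OF p] c upset_subset by blast
      then show False using empty fst_ep_closed[OF q c(1)] upset_closed[OF _ c(2)] by blast
    qed
    with le show ?thesis by blast
  qed
qed

text \<open>An obstruction \<open>c\<close> in \<open>C\<close> labels a cover inside the interval
  by \<open>cover_between\<close>, and that cover would itself not be collapsed.\<close>

lemma cover_determined_fiber: "cover_determined \<P> (fiber_congruence \<P> (restrict_pair C))"
  unfolding cover_determined_def Pairs_simps
proof (intro ballI impI, elim conjE)
  let ?\<Theta> = "fiber_congruence \<P> (restrict_pair C)"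
  fix p q assume p: "p \<in> carrier \<P>" and q: "q \<in> carrier \<P>" and le: "fst p \<subseteq> fst q"
    and covers: "\<forall>u v. fst p \<subseteq> fst u \<and> covered_by \<P> u v \<and> fst v \<subseteq> fst q \<longrightarrow> (u, v) \<in> ?\<Theta>"
  have False if c: "c \<in> fst q" "c \<in> snd p" "c \<in> C" for c
  proof -
    obtain u v where uv: "covered_by \<P> u v" "fst p \<subseteq> fst u" "fst v \<subseteq> fst q" "c \<in> fst v" "c \<in> snd u"
      using cover_between[OF p q le c(1,2)] by blast
    then have "u \<in> carrier \<P>" "v \<in> carrier \<P>" "fst u \<subseteq> fst v" "(u, v) \<in> ?\<Theta>"
      using covers unfolding covered_by_def Pairs_simps by blast+
    then show False using fiber_restrict_le_iff uv c(3) by blast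
  qed
  then show "(p, q) \<in> ?\<Theta>" using fiber_restrict_le_iff[OF p q le] by blast
qed

end

section \<open>Recovering a cover-determined congruence from its contracted elements\<close>

lemma cover_determined_le_iff:
  assumes cong: "lattice_congruence \<P> \<Theta>" and cd: "cover_determined \<P> \<Theta>"
    and p: "p \<in> carrier \<P>" and q: "q \<in> carrier \<P>" and le: "fst p \<subseteq> fst q"
  shows "(p, q) \<in> \<Theta> \<longleftrightarrow> (\<forall>c\<in>fst q \<inter> snd p. contracted \<Theta> c)"
proof
  show "\<forall>c\<in>fst q \<inter> snd p. contracted \<Theta> c" if "(p, q) \<in> \<Theta>"
    using congruent_imp_contracted[OF cong p q that] by blast
  assume contr: "\<forall>c\<in>fst q \<inter> snd p. contracted \<Theta> c"
  have "(u, v) \<in> \<Theta>" if pu: "fst p \<subseteq> fst u" and cov: "covered_by \<P> u v" and vq: "fst v \<subseteq> fst q" for u v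
  proof -
    have u: "u \<in> carrier \<P>" and v: "v \<in> carrier \<P>" and "fst u \<subseteq> fst v" "u \<noteq> v"
      using cov unfolding covered_by_def Pairs_simps by blast+
    \<comment> \<open>A label for the cover: start from any element gained in the first component
      and follow \<open>ep\<close> into \<open>snd u\<close>. By monotonicity the label also lies in
      \<open>fst q\<close> and \<open>snd p\<close>.\<close>
    then obtain x where x: "x \<in> fst v" "x \<notin> fst u" using Pairs_eqI1[OF u v] by blast
    then obtain c where c: "c \<in> snd u" "(x, c) \<in> ep"
      using ep_into_snd[OF u] fst_subset[OF v] by blast
    then have cv: "c \<in> fst v" using fst_ep_closed[OF v x(1)] by blast
    then have "contracted \<Theta> c"
      using contr vq c(1) pu fst_subset_iff_snd_subset[OF p u] by blast
    then show ?thesis using cover_congruentI[OF cong cov cv c(1)] by blast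
  qed
  then show "(p, q) \<in> \<Theta>" using cd p q le unfolding cover_determined_def Pairs_simps by blast
qed

text \<open>On comparable pairs both congruences amount to the same test: no noncontracted element
  lies in \<open>fst q \<inter> snd p\<close>. The general case follows by
  \<open>lattice_congruence_iff_meet\<close>.\<close>

lemma cover_determined_eq_fiber:
  assumes cong: "lattice_congruence \<P> \<Theta>" and cd: "cover_determined \<P> \<Theta>"
  shows "\<Theta> = fiber_congruence \<P> (restrict_pair {c \<in> S. \<not> contracted \<Theta> c})"
    (is "_ = fiber_congruence _ (restrict_pair ?C)")
proof -
  note C = squig_upset_noncontracted[OF cong]
  let ?F = "fiber_congruence \<P> (restrict_pair ?C)"
  have F: "lattice_congruence \<P> ?F"
    using complete_congruence_fiber[OF restrict_pair_hom[OF C]] by (simp add: complete_congruence_def)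
  have le: "(p, q) \<in> \<Theta> \<longleftrightarrow> (p, q) \<in> ?F"
    if p: "p \<in> carrier \<P>" and q: "q \<in> carrier \<P>" and "fst p \<subseteq> fst q" for p q
    unfolding cover_determined_le_iff[OF cong cd that] fiber_restrict_le_iff[OF C that]
    using fst_subset[OF q] by blast
  have "(p, q) \<in> \<Theta> \<longleftrightarrow> (p, q) \<in> ?F" if pq: "p \<in> carrier \<P>" "q \<in> carrier \<P>" for p q
    unfolding lattice_congruence_iff_meet[OF cong pq] lattice_congruence_iff_meet[OF F pq]
    using le[OF meet_Pairs_closed[OF pq] pq(1)] le[OF meet_Pairs_closed[OF pq] pq(2)]
    by (simp add: fst_meet_Pairs[OF pq])
  moreover have "\<Theta> \<subseteq> carrier \<P> \<times> carrier \<P>" "?F \<subseteq> carrier \<P> \<times> carrier \<P>"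
    using cong F unfolding lattice_congruence_def equiv_def by blast+
  ultimately show ?thesis by blast
qed

end

theorem theorem6p3:
  fixes S :: "'a set" and ar ep mo :: "'a rel"
  assumes "factorization_system S ar ep mo"
    and "two_acyclic ep mo"
    and "image_condition S ar ep mo"
  shows "(\<forall>C. squig_upset S ep mo C \<longrightarrow>
            factorization_system C (Restr ar C) (Restr ep C) (Restr mo C) \<and>
            two_acyclic (Restr ep C) (Restr mo C) \<and>
            image_condition C (Restr ar C) (Restr ep C) (Restr mo C) \<and>
            complete_lattice_hom (Pairs S ar) (Pairs C (Restr ar C)) (restrict_pair C) \<and>
            restrict_pair C ` carrier (Pairs S ar) = carrier (Pairs C (Restr ar C)) \<and>
            complete_congruence (Pairs S ar) (fiber_congruence (Pairs S ar) (restrict_pair C)) \<and>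
            cover_determined (Pairs S ar) (fiber_congruence (Pairs S ar) (restrict_pair C))) \<and>
         (\<forall>\<Theta>. complete_congruence (Pairs S ar) \<Theta> \<and> cover_determined (Pairs S ar) \<Theta> \<longrightarrow>
            (\<exists>C. squig_upset S ep mo C \<and>
                 \<Theta> = fiber_congruence (Pairs S ar) (restrict_pair C)))"
proof -
  interpret two_acyclic_factorization_system S ar ep mo
    using assms by unfold_locales
  show ?thesis
  proof (intro conjI allI impI; (elim conjE)?)
    fix C assume C: "squig_upset S ep mo C"
    show "factorization_system C (Restr ar C) (Restr ep C) (Restr mo C)"
      by (rule factorization_system_Restr[OF C])
    show "two_acyclic (Restr ep C) (Restr mo C)"
      by (rule two_acyclic_Restr[OF C])
    show "image_condition C (Restr ar C) (Restr ep C) (Restr mo C)"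
      by (rule image_condition_Restr[OF C])
    show hom: "complete_lattice_hom \<P> (Pairs C (Restr ar C)) (restrict_pair C)"
      by (rule restrict_pair_hom[OF C])
    show "restrict_pair C ` carrier \<P> = carrier (Pairs C (Restr ar C))"
      by (rule restrict_pair_surj[OF C])
    show "complete_congruence \<P> (fiber_congruence \<P> (restrict_pair C))"
      by (rule complete_congruence_fiber[OF hom])
    show "cover_determined \<P> (fiber_congruence \<P> (restrict_pair C))"
      by (rule cover_determined_fiber[OF C])
  next
    fix \<Theta> assume "complete_congruence \<P> \<Theta>" and cd: "cover_determined \<P> \<Theta>"
    then have cong: "lattice_congruence \<P> \<Theta>" by (simp add: complete_congruence_def)
    show "\<exists>C. squig_upset S ep mo C \<and> \<Theta> = fiber_congruence \<P> (restrict_pair C)"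
      using squig_upset_noncontracted[OF cong] cover_determined_eq_fiber[OF cong cd] by blast
  qed
qed

end
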